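(* Let $X$ be a compact metric space, $f:X\to X$ a continuous map and $\mu$ an $f$-invariant Borel probability measure. Let $f_\infty$ be the constant sequence $f_n=f$ on the constant sequence of spaces $X_n=X$, and $\mu_\infty$ the constant sequence $\mu_n=\mu$. Then the metric entropy $h(f_\infty,\mu_\infty):=\sup_{\mathcal{P}_\infty\in\mathcal{E}_{\mathrm M}(\mu_\infty)}h(f_\infty,\mu_\infty;\mathcal{P}_\infty)$ is equal to the usual Kolmogorov–Sinai metric entropy $h_\mu(f)$.
   Context: Let $d$ be the metric of $X$. $\mathcal{E}_{\mathrm M}(\mu_\infty)$ (with $\mu_n=\mu$ for all $n$) is the family of admissible sequences: a sequence $\mathcal{P}_\infty=(\mathcal{P}_n)_{n\ge0}$ of finite Borel partitions $\mathcal{P}_n=\{P_{n,1},\dots,P_{n,k_n}\}$ of $X$ is in $\mathcal{E}_{\mathrm M}(\mu_\infty)$ iff $(k_n)$ is bounded and for each $\varepsilon>0$ there are $\delta>0$ and compact (possibly empty) sets $K_{n,i}\subset P_{n,i}$ such that for all $n\ge0$: (a) $\mu_n(P_{n,i}\setminus K_{n,i})\le\varepsilon$ for $i=1,\dots,k_n$; (b) for $1\le i<j\le k_n$, $d(x,y)\ge\delta$ for all $x\in K_{n,i}$, $y\in K_{n,j}$. For a sequence $\mathcal{P}_\infty$ of finite Borel partitions, $h(f_\infty,\mu_\infty;\mathcal{P}_\infty):=\limsup_{n\to\infty}\frac1nH_{\mu}\big(\bigvee_{i=0}^{n-1}f^{-i}\mathcal{P}_i\big)$, where $H_\mu(\mathcal{P})=-\sum_{P\in\mathcal{P}}\mu(P)\log\mu(P)$.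 *)

theory Defs
  imports "HOL-Probability.Probability"
begin

text \<open>
  Partitions are sets of nonempty cells (\<open>partition_on\<close>). Discarding empty cells changes
  neither entropies (as \<open>0 log 0 = 0\<close>; in Isabelle \<open>ln 0 = 0\<close>) nor admissibility (an empty cell
  would carry the empty compact set).
\<close>

definition finite_borel_partition :: "'a::topological_space set set \<Rightarrow> bool" where
  "finite_borel_partition P \<longleftrightarrow> finite P \<and> partition_on UNIV P \<and> P \<subseteq> sets borel"

definition preimage_partition :: "('a \<Rightarrow> 'b) \<Rightarrow> 'b set set \<Rightarrow> 'a set set" where
  "preimage_partition g P = ((\<lambda>A. g -` A) ` P) - {{}}"

definition partition_entropy :: "'a measure \<Rightarrow> 'a set set \<Rightarrow> real" where
  "partition_entropy M P = - (\<Sum>A\<in>P. measure M A * ln (measure M A))"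

text \<open>
  A nonautonomous system on the constant sequence of spaces \<open>UNIV :: 'a set\<close>:
  \<open>orbit_map f i = f (i - 1) \<circ> \<dots> \<circ> f 0\<close>, which is \<open>g ^^ i\<close> if \<open>f n = g\<close> for all \<open>n\<close>.
\<close>

primrec orbit_map :: "(nat \<Rightarrow> 'a \<Rightarrow> 'a) \<Rightarrow> nat \<Rightarrow> 'a \<Rightarrow> 'a" where
  "orbit_map f 0 = id"
| "orbit_map f (Suc n) = f n \<circ> orbit_map f n"

text \<open>
  The join of the pulled-back partitions with index \<open>i < n\<close>. The library's \<open>common_refinement\<close>
  takes a set of partitions, so coinciding pull-backs are listed once; this is harmless because
  the join is idempotent.
\<close>

definition orbit_join :: "(nat \<Rightarrow> 'a \<Rightarrow> 'a) \<Rightarrow> (nat \<Rightarrow> 'a set set) \<Rightarrow> nat \<Rightarrow> 'a set set" where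
  "orbit_join f P n = common_refinement ((\<lambda>i. preimage_partition (orbit_map f i) (P i)) ` {..<n})"

definition entropy_wrt_partitions ::
    "(nat \<Rightarrow> 'a \<Rightarrow> 'a) \<Rightarrow> (nat \<Rightarrow> 'a measure) \<Rightarrow> (nat \<Rightarrow> 'a set set) \<Rightarrow> ereal" where
  "entropy_wrt_partitions f \<mu> P =
     limsup (\<lambda>n. ereal (partition_entropy (\<mu> 0) (orbit_join f P n) / real n))"

text \<open>
  The admissible class \<open>E\<^sub>M\<close>. The cells of \<open>P n\<close> index themselves: \<open>K n A\<close> is the compact
  subset chosen inside the cell \<open>A \<in> P n\<close>, and \<open>card (P n)\<close> is \<open>k\<^sub>n\<close>.
\<close>

definition admissible_partitions ::
    "(nat \<Rightarrow> 'a::metric_space measure) \<Rightarrow> (nat \<Rightarrow> 'a set set) set" where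
  "admissible_partitions \<mu> = {P.
     (\<forall>n. finite_borel_partition (P n)) \<and>
     (\<exists>k. \<forall>n. card (P n) \<le> k) \<and>
     (\<forall>\<epsilon>>0. \<exists>\<delta>>0. \<exists>K :: nat \<Rightarrow> 'a set \<Rightarrow> 'a set. \<forall>n.
        (\<forall>A\<in>P n. compact (K n A) \<and> K n A \<subseteq> A \<and> measure (\<mu> n) (A - K n A) \<le> \<epsilon>) \<and>
        (\<forall>A\<in>P n. \<forall>B\<in>P n. A \<noteq> B \<longrightarrow> (\<forall>x\<in>K n A. \<forall>y\<in>K n B. dist x y \<ge> \<delta>)))}"

definition nonautonomous_entropy ::
    "(nat \<Rightarrow> 'a::metric_space \<Rightarrow> 'a) \<Rightarrow> (nat \<Rightarrow> 'a measure) \<Rightarrow> ereal" where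
  "nonautonomous_entropy f \<mu> = (SUP P\<in>admissible_partitions \<mu>. entropy_wrt_partitions f \<mu> P)"

text \<open>
  The classical Kolmogorov--Sinai entropy. The limit exists for invariant probability measures,
  by subadditivity.
\<close>

definition ks_entropy_partition :: "('a \<Rightarrow> 'a) \<Rightarrow> 'a measure \<Rightarrow> 'a set set \<Rightarrow> ereal" where
  "ks_entropy_partition f M P =
     lim (\<lambda>n. ereal (partition_entropy M
       (common_refinement ((\<lambda>i. preimage_partition (f ^^ i) P) ` {..<n})) / real n))"

definition ks_entropy :: "('a::topological_space \<Rightarrow> 'a) \<Rightarrow> 'a measure \<Rightarrow> ereal" where
  "ks_entropy f M = (SUP P\<in>{P. finite_borel_partition P}. ks_entropy_partition f M P)"

end

theory Submission
  imports Defs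
begin

text \<open>
  A constant sequence is admissible, because finite Borel measures on compact metric spaces are
  inner regular and finitely many disjoint compact sets are uniformly separated. Conversely, an
  admissible sequence comes with compact sets that are \<open>\<delta>\<close>-separated uniformly in the
  index; hence a single finite partition \<open>Q\<close> with cells of diameter less than \<open>\<delta>\<close>
  predicts the cell of every \<open>P n\<close> up to a small error, and Fano's inequality makes
  the conditional entropy of \<open>P n\<close> given \<open>Q\<close> uniformly small. As conditional
  entropies add up along orbits, passing from \<open>P\<close> to the constant sequence \<open>Q\<close>
  costs an arbitrarily small amount per step.

  The entropy of a partition into level sets depends only on the kernel of the function, so joins
  of partitions become tuples and lists of functions.
\<close>

section \<open>Subadditive sequences\<close>

lemma subadditive_mult_le:
  fixes u :: "nat \<Rightarrow> real"
  assumes "\<And>m n. u (m + n) \<le> u m + u n"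
  shows "u (q * m + r) \<le> real q * u m + u r"
proof (induction q)
  case (Suc q)
  have "u (Suc q * m + r) \<le> u m + u (q * m + r)"
    using assms[of m "q * m + r"] by (simp add: add.assoc)
  with Suc show ?case by (simp add: algebra_simps)
qed simp

text \<open>The limit is the infimum \<open>L\<close> of the quotients. For the upper bound,
  \<open>n\<close> is divided with remainder by an \<open>m\<close> whose quotient is already close
  to \<open>L\<close>.\<close>

lemma fekete:
  fixes u :: "nat \<Rightarrow> real"
  assumes sub: "\<And>m n. u (m + n) \<le> u m + u n" and nonneg: "\<And>n. 0 \<le> u n"
  shows "convergent (\<lambda>n. u n / real n)"
proof -
  define L where "L = (INF n\<in>{1..}. u n / real n)"
  have bdd: "bdd_below ((\<lambda>n. u n / real n) ` {1..})"
    using nonneg by (intro bdd_belowI[of _ 0]) auto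
  have "(\<lambda>n. u n / real n) \<longlonglongrightarrow> L"
  proof (rule order_tendstoI)
    fix a assume "a < L"
    moreover have "L \<le> u n / real n" if "n \<ge> 1" for n
      unfolding L_def using bdd that by (intro cINF_lower) auto
    ultimately show "\<forall>\<^sub>F n in sequentially. a < u n / real n"
      by (intro eventually_sequentiallyI[of 1]) (metis less_le_trans)
  next
    fix a assume "L < a"
    then obtain m where m: "m \<ge> 1" "u m / real m < a"
      unfolding L_def using bdd by (subst (asm) cINF_less_iff) auto
    define C where "C = (\<Sum>r<m. u r)"
    \<comment> \<open>Summing over all possible remainders makes \<open>C\<close> independent of
      \<open>n\<close>, so that \<open>C / n\<close> vanishes in the limit.\<close>
    have le: "u n / real n \<le> u m / real m + C / real n" if "n \<ge> 1" for n
    proof -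
      have "u n = u (n div m * m + n mod m)" by simp
      also have "\<dots> \<le> real (n div m) * u m + u (n mod m)"
        using subadditive_mult_le[of u "n div m" m "n mod m"] sub by blast
      also have "u (n mod m) \<le> C"
        unfolding C_def using m nonneg by (intro member_le_sum) auto
      also have "real (n div m) * u m \<le> real n / real m * u m"
        using nonneg by (intro mult_right_mono of_nat_div_le_of_nat) auto
      finally show ?thesis using that by (simp add: field_simps)
    qed
    have "(\<lambda>n. u m / real m + C / real n) \<longlonglongrightarrow> u m / real m + 0"
      by (intro tendsto_intros lim_const_over_n)
    then have "\<forall>\<^sub>F n in sequentially. u m / real m + C / real n < a"
      using m by (auto dest: order_tendstoD)
    then show "\<forall>\<^sub>F n in sequentially. u n / real n < a"
      using eventually_ge_at_top[of 1] by eventually_elim (use le in fastforce)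
  qed
  then show ?thesis by (rule convergentI)
qed

section \<open>Regularity of finite Borel measures on metric spaces\<close>

text \<open>The tails decrease to the empty set, so continuity from above applies. This cuts
  countable unions down to finite ones, which stay closed when their members are.\<close>

lemma (in finite_measure) measure_Diff_UN_small:
  fixes A :: "nat \<Rightarrow> 'a set"
  assumes A: "range A \<subseteq> sets M" and e: "0 < e"
  shows "\<exists>n. measure M ((\<Union>i. A i) - (\<Union>i<n. A i)) < e"
proof -
  let ?B = "\<lambda>n. (\<Union>i. A i) - (\<Union>i<n. A i)"
  have "(\<lambda>n. measure M (?B n)) \<longlonglongrightarrow> measure M (\<Inter>n. ?B n)"
    using A by (intro finite_Lim_measure_decseq) (auto simp: decseq_def)
  moreover have eq: "(\<Inter>n. ?B n) = {}" by auto
  ultimately have "(\<lambda>n. measure M (?B n)) \<longlonglongrightarrow> 0"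
    unfolding eq by (simp del: UN_extend_simps)
  then have "\<forall>\<^sub>F n in sequentially. measure M (?B n) < e"
    using e by (rule order_tendstoD)
  then show ?thesis by (auto simp: eventually_sequentially)
qed


text \<open>The points at distance at least \<open>1 / (n + 1)\<close> from the complement form
  closed sets that exhaust \<open>G\<close>.\<close>

lemma open_closed_approx:
  fixes M :: "'a::metric_space measure"
  assumes fm: "finite_measure M" and M: "sets M = sets borel" and "open G" and e: "0 < e"
  shows "\<exists>F. closed F \<and> F \<subseteq> G \<and> measure M (G - F) < e"
\<comment> \<open>\<open>infdist\<close> to the empty set is 0 by convention, so for this
  \<open>G\<close> the sets \<open>F n\<close> below would all be empty.\<close>
proof (cases "G = UNIV")
  case True
  then show ?thesis using e by (intro exI[of _ UNIV]) auto
next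
  case False
  define F where "F n = {x. 1 / real (Suc n) \<le> infdist x (- G)}" for n
  have cl: "closed (F n)" for n
    unfolding F_def by (intro closed_Collect_le continuous_intros)
  have UN: "(\<Union>n. F n) = G"
  proof -
    have "x \<in> G \<longleftrightarrow> 0 < infdist x (- G)" for x
    proof -
      have "x \<in> - G \<longleftrightarrow> infdist x (- G) = 0"
        using \<open>open G\<close> False by (intro in_closed_iff_infdist_zero) (auto simp: closed_Compl)
      then show ?thesis using infdist_nonneg[of x "- G"] by (auto simp: less_le)
    qed
    moreover have "0 < infdist x (- G) \<longleftrightarrow> (\<exists>n. x \<in> F n)" for x
    proof
      assume "0 < infdist x (- G)"
      then obtain n where "1 / real (Suc n) < infdist x (- G)" by (rule nat_approx_posE)
      then show "\<exists>n. x \<in> F n" unfolding F_def by (auto intro: less_imp_le)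
    next
      assume "\<exists>n. x \<in> F n"
      then obtain n where "1 / real (Suc n) \<le> infdist x (- G)" by (auto simp: F_def)
      moreover have "0 < 1 / real (Suc n)" by simp
      ultimately show "0 < infdist x (- G)" by linarith
    qed
    ultimately show ?thesis by auto
  qed
  obtain n where n: "measure M ((\<Union>i. F i) - (\<Union>i<n. F i)) < e"
    using finite_measure.measure_Diff_UN_small[OF fm, of F e] cl M e
    by (metis borel_closed image_subsetI)
  show ?thesis
  proof (intro exI conjI)
    show "closed (\<Union>i<n. F i)" using cl by auto
    show "(\<Union>i<n. F i) \<subseteq> G" using UN by auto
    show "measure M (G - (\<Union>i<n. F i)) < e" using n UN by simp
  qed
qed

text \<open>Induction over the generated sigma-algebra. Approximating from inside and outside at
  once carries the complement step: complementation exchanges the roles of \<open>F\<close> and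
  \<open>U\<close> and keeps the difference set.\<close>

lemma borel_closed_open_approx:
  fixes M :: "'a::metric_space measure"
  assumes fm: "finite_measure M" and M: "sets M = sets borel" and B: "B \<in> sets borel" and "0 < e"
  shows "\<exists>F U. closed F \<and> open U \<and> F \<subseteq> B \<and> B \<subseteq> U \<and> measure M (U - F) < e"
proof -
  interpret finite_measure M by (rule fm)
  have "B \<in> sigma_sets UNIV {S. open S}"
    using B by (simp add: borel_def)
  then show ?thesis using \<open>0 < e\<close>
  proof (induction arbitrary: e rule: sigma_sets.induct)
    case (Basic G)
    then show ?case using open_closed_approx[OF fm M, of G e] by auto
  next
    case Empty
    then show ?case by (intro exI[of _ "{}"]) auto
  next
    case (Compl B)
    from Compl.IH[OF Compl.prems] obtain F U where
      "closed F" "open U" "F \<subseteq> B" "B \<subseteq> U" "measure M (U - F) < e" by blast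
    moreover have "- F - - U = U - F" by auto
    ultimately show ?case
      by (intro exI[of _ "- U"] exI[of _ "- F"]) auto
  next
    case (Union B)
    \<comment> \<open>The budgets \<open>d i\<close> add up to \<open>e / 2\<close>. The other half
      pays for truncating the union of the \<open>F i\<close>, since an infinite union of closed
      sets need not be closed.\<close>
    define d where "d i = e / 2 * (1 / 2) ^ Suc i" for i
    have "0 < d i" for i using Union.prems by (simp add: d_def)
    then have "\<forall>i. \<exists>F U. closed F \<and> open U \<and> F \<subseteq> B i \<and> B i \<subseteq> U \<and> measure M (U - F) < d i"
      using Union.IH by blast
    then obtain F U where FU: "\<And>i. closed (F i)" "\<And>i. open (U i)" "\<And>i. F i \<subseteq> B i"
      "\<And>i. B i \<subseteq> U i" "\<And>i. measure M (U i - F i) < d i" by metis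
    have d: "d sums (e / 2)"
      unfolding d_def using sums_mult[OF power_half_series, of "e / 2"] by simp
    have sm: "summable (\<lambda>i. measure M (U i - F i))"
      by (rule summable_comparison_test'[OF sums_summable[OF d], of 0])
        (use FU(5) in \<open>auto intro: less_imp_le\<close>)
    have mF: "F i \<in> sets M" and mU: "U i \<in> sets M" for i
      using FU M by auto
    have "measure M (\<Union>i. U i - F i) \<le> (\<Sum>i. measure M (U i - F i))"
      using mF mU sm by (intro finite_measure_subadditive_countably) auto
    also have "\<dots> \<le> suminf d"
      using sm d FU(5) by (intro suminf_le) (auto intro: less_imp_le sums_summable)
    also have "\<dots> = e / 2" using d by (simp add: sums_iff)
    finally have 1: "measure M (\<Union>i. U i - F i) \<le> e / 2" .
    obtain n where n: "measure M ((\<Union>i. F i) - (\<Union>i<n. F i)) < e / 2"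
      using finite_measure.measure_Diff_UN_small[OF fm, of F "e / 2"] mF Union.prems by auto
    have "measure M ((\<Union>i. U i) - (\<Union>i<n. F i))
        \<le> measure M ((\<Union>i. U i - F i) \<union> ((\<Union>i. F i) - (\<Union>i<n. F i)))"
      using mF mU by (intro finite_measure_mono sets.Un sets.Diff sets.countable_UN) auto
    also have "\<dots> \<le> measure M (\<Union>i. U i - F i) + measure M ((\<Union>i. F i) - (\<Union>i<n. F i))"
      using mF mU by (intro measure_Un_le sets.Diff sets.countable_UN) auto
    also have "\<dots> < e" using 1 n by simp
    finally have "measure M ((\<Union>i. U i) - (\<Union>i<n. F i)) < e" .
    then show ?case
      using FU by (intro exI[of _ "\<Union>i<n. F i"] exI[of _ "\<Union>i. U i"]) (auto; blast)
  qed
qed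

section \<open>Entropy of functions with finitely many values\<close>

text \<open>Termwise \<open>ln t \<le> t - 1\<close> with \<open>t = w i / a i\<close>. Positivity
  of \<open>w\<close> where \<open>a\<close> is positive keeps the convention
  \<open>ln 0 = 0\<close> from entering with a nonzero factor.\<close>

lemma gibbs_inequality:
  fixes a w :: "'i \<Rightarrow> real"
  assumes a: "\<And>i. i \<in> I \<Longrightarrow> 0 \<le> a i" and w: "\<And>i. i \<in> I \<Longrightarrow> 0 \<le> w i"
    and pos: "\<And>i. i \<in> I \<Longrightarrow> 0 < a i \<Longrightarrow> 0 < w i"
    and le: "(\<Sum>i\<in>I. w i) \<le> (\<Sum>i\<in>I. a i)"
  shows "(\<Sum>i\<in>I. a i * ln (w i)) \<le> (\<Sum>i\<in>I. a i * ln (a i))"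
proof -
  have "a i * ln (w i) - a i * ln (a i) \<le> w i - a i" if "i \<in> I" for i
  proof (cases "a i = 0")
    case False
    then have *: "0 < a i" "0 < w i" using a pos that by force+
    then have "a i * ln (w i / a i) \<le> a i * (w i / a i - 1)"
      by (intro mult_left_mono ln_le_minus_one) simp_all
    then show ?thesis using * by (simp add: ln_div right_diff_distrib)
  qed (use w that in simp)
  then have "(\<Sum>i\<in>I. a i * ln (w i) - a i * ln (a i)) \<le> (\<Sum>i\<in>I. w i - a i)"
    by (rule sum_mono)
  then show ?thesis using le by (simp add: sum_subtractf)
qed

text \<open>The partition generated by a function; indexing by the range keeps the empty set out of
  it.\<close>

definition level_sets :: "('a \<Rightarrow> 'i) \<Rightarrow> 'a set set" where
  "level_sets X = (\<lambda>i. X -` {i}) ` range X"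

lemma level_sets_alt: "level_sets X = range (\<lambda>x. {y. X y = X x})"
  by (auto simp: level_sets_def vimage_def)

lemma level_sets_cong:
  assumes "\<And>x y. X x = X y \<longleftrightarrow> Y x = Y y"
  shows "level_sets X = level_sets Y"
  using assms by (simp add: level_sets_alt)

text \<open>Values outside the range have an empty fibre and contribute 0. Hence any finite superset
  can index the sum, in particular the product of the ranges for a tuple of functions.\<close>

lemma partition_entropy_level_sets:
  assumes "finite S" "range X \<subseteq> S"
  shows "partition_entropy M (level_sets X)
    = - (\<Sum>i\<in>S. measure M (X -` {i}) * ln (measure M (X -` {i})))"
proof -
  have "(\<Sum>A\<in>level_sets X. measure M A * ln (measure M A))
      = (\<Sum>i\<in>range X. measure M (X -` {i}) * ln (measure M (X -` {i})))"
    unfolding level_sets_def by (subst sum.reindex) (auto simp: inj_on_def)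
  also have "\<dots> = (\<Sum>i\<in>S. measure M (X -` {i}) * ln (measure M (X -` {i})))"
  proof (rule sum.mono_neutral_left[OF assms], safe)
    fix i assume "i \<notin> range X"
    then have "X -` {i} = {}" by auto
    then show "measure M (X -` {i}) * ln (measure M (X -` {i})) = 0" by simp
  qed
  finally show ?thesis by (simp add: partition_entropy_def)
qed

lemma sum_triple:
  "(\<Sum>(i, j, k)\<in>A \<times> B \<times> C. h i j k) = (\<Sum>i\<in>A. \<Sum>j\<in>B. \<Sum>k\<in>C. h i j k)"
  by (simp flip: sum.cartesian_product)

locale full_prob_space = prob_space +
  assumes space_UNIV: "space M = UNIV"
begin

abbreviation entropy_of :: "('a \<Rightarrow> 'i) \<Rightarrow> real" where
  "entropy_of X \<equiv> partition_entropy M (level_sets X)"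

lemma simple_function_finite_range: "simple_function M X \<Longrightarrow> finite (range X)"
  by (simp add: simple_function_def space_UNIV)

lemma simple_function_vimage_sets: "simple_function M X \<Longrightarrow> X -` A \<in> sets M"
  using simple_functionD(2)[of M X A] by (simp add: space_UNIV)

lemma partition_entropy_nonneg: "0 \<le> partition_entropy M P"
proof -
  have "prob A * ln (prob A) \<le> 0" for A
    by (cases "prob A = 0") (auto intro!: mult_nonneg_nonpos simp: ln_le_zero_iff zero_less_measure_iff)
  then show ?thesis by (simp add: partition_entropy_def sum_nonpos)
qed

lemma prob_marginal:
  assumes "simple_function M X" "simple_function M Y"
  shows "prob (X -` {i}) = (\<Sum>j\<in>range Y. prob ((\<lambda>x. (X x, Y x)) -` {(i, j)}))"
proof -
  have "prob (\<Union>j\<in>range Y. (\<lambda>x. (X x, Y x)) -` {(i, j)})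
      = (\<Sum>j\<in>range Y. prob ((\<lambda>x. (X x, Y x)) -` {(i, j)}))"
    using assms
    by (intro finite_measure_finite_Union)
      (auto simp: disjoint_family_on_def intro!: simple_function_vimage_sets simple_function_finite_range)
  moreover have "(\<Union>j\<in>range Y. (\<lambda>x. (X x, Y x)) -` {(i, j)}) = X -` {i}" by auto
  ultimately show ?thesis by simp
qed

lemma prob_pair_le:
  assumes "simple_function M X"
  shows "prob ((\<lambda>x. (X x, Y x)) -` {(i, j)}) \<le> prob (X -` {i})"
  using assms by (intro finite_measure_mono) (auto intro: simple_function_vimage_sets)

lemma sum_prob_range:
  assumes "simple_function M X"
  shows "(\<Sum>i\<in>range X. prob (X -` {i})) = 1"
proof -
  have "(\<Sum>i\<in>range X. prob (X -` {i})) = prob (\<Union>i\<in>range X. X -` {i})"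
    using assms
    by (intro finite_measure_finite_Union[symmetric])
      (auto simp: disjoint_family_on_def intro!: simple_function_vimage_sets simple_function_finite_range)
  also have "(\<Union>i\<in>range X. X -` {i}) = space M" by (auto simp: space_UNIV)
  finally show ?thesis by (simp add: prob_space)
qed

lemma entropy_of_pair:
  assumes "simple_function M X" "simple_function M Y"
  shows "entropy_of (\<lambda>x. (X x, Y x)) = - (\<Sum>i\<in>range X. \<Sum>j\<in>range Y.
    prob ((\<lambda>x. (X x, Y x)) -` {(i, j)}) * ln (prob ((\<lambda>x. (X x, Y x)) -` {(i, j)})))"
  using assms
  by (subst partition_entropy_level_sets[of "range X \<times> range Y"])
    (auto simp: simple_function_finite_range sum.cartesian_product)

lemma entropy_of_single:
  assumes "simple_function M X"
  shows "entropy_of X = - (\<Sum>i\<in>range X. prob (X -` {i}) * ln (prob (X -` {i})))"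
  using assms by (subst partition_entropy_level_sets[of "range X"])
    (auto simp: simple_function_finite_range)

lemma entropy_of_marginal:
  assumes "simple_function M X" "simple_function M Y"
  shows "entropy_of X = - (\<Sum>i\<in>range X. \<Sum>j\<in>range Y.
    prob ((\<lambda>x. (X x, Y x)) -` {(i, j)}) * ln (prob (X -` {i})))"
  by (simp add: entropy_of_single[OF assms(1)] prob_marginal[OF assms] flip: sum_distrib_right)

text \<open>A joint fibre is contained in the fibre of \<open>X\<close>, so monotonicity of
  \<open>ln\<close> applies term by term; null fibres drop out.\<close>

lemma entropy_of_mono_pair:
  assumes X: "simple_function M X" and Y: "simple_function M Y"
  shows "entropy_of X \<le> entropy_of (\<lambda>x. (X x, Y x))"
proof -
  have "prob ((\<lambda>x. (X x, Y x)) -` {(i, j)}) * ln (prob ((\<lambda>x. (X x, Y x)) -` {(i, j)}))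
      \<le> prob ((\<lambda>x. (X x, Y x)) -` {(i, j)}) * ln (prob (X -` {i}))" (is "?p * _ \<le> _") for i j
  proof (cases "?p = 0")
    case False
    then have "0 < ?p" by (simp add: zero_less_measure_iff)
    then have "ln ?p \<le> ln (prob (X -` {i}))"
      using prob_pair_le[OF X, of Y i j] by (intro ln_mono) auto
    then show ?thesis by (intro mult_left_mono) auto
  qed simp
  then show ?thesis
    by (simp add: entropy_of_marginal[OF X Y] entropy_of_pair[OF X Y] sum_mono)
qed

text \<open>Gibbs' inequality against the law under which \<open>X\<close> and \<open>Z\<close> are conditionally independent
  given \<open>Y\<close>.\<close>

lemma entropy_of_submodular:
  assumes X: "simple_function M X" and Y: "simple_function M Y" and Z: "simple_function M Z"
  shows "entropy_of (\<lambda>x. (X x, Y x, Z x)) + entropy_of Y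
    \<le> entropy_of (\<lambda>x. (X x, Y x)) + entropy_of (\<lambda>x. (Y x, Z x))"
proof -
  let ?I = "range X \<times> range Y \<times> range Z"
  define a where "a i j k = prob ((\<lambda>x. (X x, Y x, Z x)) -` {(i, j, k)})" for i j k
  define xy where "xy i j = prob ((\<lambda>x. (X x, Y x)) -` {(i, j)})" for i j
  define yz where "yz j k = prob ((\<lambda>x. (Y x, Z x)) -` {(j, k)})" for j k
  define y where "y j = prob (Y -` {j})" for j
  define w where "w i j k = xy i j * yz j k / y j" for i j k
  note sf = X Y Z simple_function_Pair[OF X Y] simple_function_Pair[OF Y Z]
    simple_function_Pair[OF X simple_function_Pair[OF Y Z]]
  note fin = sf(1-3)[THEN simple_function_finite_range]
  have xy: "xy i j = (\<Sum>k\<in>range Z. a i j k)" for i j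
    using prob_marginal[OF sf(4) Z, of "(i, j)"]
    by (simp add: xy_def a_def vimage_def conj_ac)
  have yz: "yz j k = (\<Sum>i\<in>range X. a i j k)" for j k
    using prob_marginal[OF sf(5) X, of "(j, k)"]
    by (simp add: yz_def a_def vimage_def conj_ac)
  have y1: "y j = (\<Sum>k\<in>range Z. yz j k)" for j
    using prob_marginal[OF Y Z] by (simp add: y_def yz_def)
  have y2: "y j = (\<Sum>i\<in>range X. xy i j)" for j
    using prob_marginal[OF Y X, of j] by (simp add: y_def xy_def vimage_def conj_ac)
  have a0: "0 \<le> a i j k" for i j k by (simp add: a_def)
  have pos: "0 < xy i j" "0 < yz j k" "0 < y j" if "0 < a i j k" "i \<in> range X" "k \<in> range Z" for i j k
  proof -
    show 1: "0 < xy i j" unfolding xy using that fin a0 by (intro sum_pos2[of _ k]) auto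
    show "0 < yz j k" unfolding yz using that fin a0 by (intro sum_pos2[of _ i]) auto
    show "0 < y j" unfolding y2 using 1 that fin by (intro sum_pos2[of _ i]) (auto simp: xy_def)
  qed
  \<comment> \<open>The quotient by \<open>y j\<close> is not cancelled yet, because
    \<open>y j\<close> may be 0. Summing over \<open>i\<close> yields
    \<open>y j * y j / y j\<close>, which equals \<open>y j\<close> even then, as division by 0
    gives 0.\<close>
  have "(\<Sum>k\<in>range Z. w i j k) = xy i j * y j / y j" for i j
    by (simp add: w_def flip: sum_divide_distrib sum_distrib_left y1)
  then have "(\<Sum>(i, j, k)\<in>?I. w i j k) = (\<Sum>i\<in>range X. \<Sum>j\<in>range Y. xy i j * y j / y j)"
    by (simp only: sum_triple)
  also have "\<dots> = (\<Sum>j\<in>range Y. \<Sum>i\<in>range X. xy i j * y j / y j)" by (rule sum.swap)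
  also have "\<dots> = (\<Sum>j\<in>range Y. y j * y j / y j)"
    by (simp only: y2 flip: sum_distrib_right sum_divide_distrib)
  also have "\<dots> = (\<Sum>j\<in>range Y. y j)" by (intro sum.cong) auto
  also have "\<dots> = (\<Sum>i\<in>range X. \<Sum>j\<in>range Y. xy i j)" unfolding y2 by (rule sum.swap)
  also have "\<dots> = (\<Sum>(i, j, k)\<in>?I. a i j k)" by (simp only: xy sum_triple)
  finally have sum_w: "(\<Sum>(i, j, k)\<in>?I. w i j k) = (\<Sum>(i, j, k)\<in>?I. a i j k)" .
  have "(\<Sum>p\<in>?I. (case p of (i, j, k) \<Rightarrow> a i j k) * ln (case p of (i, j, k) \<Rightarrow> w i j k))
      \<le> (\<Sum>p\<in>?I. (case p of (i, j, k) \<Rightarrow> a i j k) * ln (case p of (i, j, k) \<Rightarrow> a i j k))"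
  proof (rule gibbs_inequality)
    fix p assume "p \<in> ?I"
    then obtain i j k where p: "p = (i, j, k)" "i \<in> range X" "k \<in> range Z" by (cases p) auto
    show "0 \<le> (case p of (i, j, k) \<Rightarrow> a i j k)" by (simp add: p a0)
    show "0 \<le> (case p of (i, j, k) \<Rightarrow> w i j k)" by (simp add: p w_def xy_def yz_def y_def)
    assume "0 < (case p of (i, j, k) \<Rightarrow> a i j k)"
    then have "0 < a i j k" by (simp add: p)
    from pos[OF this p(2,3)] show "0 < (case p of (i, j, k) \<Rightarrow> w i j k)" by (simp add: p w_def)
  qed (simp add: sum_w)
  then have "(\<Sum>(i, j, k)\<in>?I. a i j k * ln (w i j k)) \<le> (\<Sum>(i, j, k)\<in>?I. a i j k * ln (a i j k))"
    by (simp add: case_prod_unfold)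
  \<comment> \<open>On the support of \<open>a\<close> all three marginals are positive, so the
    logarithm of \<open>w\<close> splits; off it both sides are 0. Each of the three sums then
    collapses to the entropy of a marginal, up to sign.\<close>
  also have "(\<Sum>(i, j, k)\<in>?I. a i j k * ln (w i j k))
      = (\<Sum>(i, j, k)\<in>?I. a i j k * ln (xy i j) + a i j k * ln (yz j k) - a i j k * ln (y j))"
  proof (intro sum.cong refl, clarify)
    fix i j k
    show "a (X i) (Y j) (Z k) * ln (w (X i) (Y j) (Z k))
      = a (X i) (Y j) (Z k) * ln (xy (X i) (Y j)) + a (X i) (Y j) (Z k) * ln (yz (Y j) (Z k))
        - a (X i) (Y j) (Z k) * ln (y (Y j))"
    proof (cases "a (X i) (Y j) (Z k) = 0")
      case False
      then have "0 < a (X i) (Y j) (Z k)" using a0[of "X i" "Y j" "Z k"] by linarith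
      from pos[OF this] show ?thesis by (simp add: w_def ln_div ln_mult ring_distribs)
    qed simp
  qed
  also have "\<dots> = (\<Sum>(i, j, k)\<in>?I. a i j k * ln (xy i j)) + (\<Sum>(i, j, k)\<in>?I. a i j k * ln (yz j k))
      - (\<Sum>(i, j, k)\<in>?I. a i j k * ln (y j))"
    by (simp add: sum.distrib sum_subtractf case_prod_unfold)
  also have "(\<Sum>(i, j, k)\<in>?I. a i j k * ln (xy i j))
      = (\<Sum>i\<in>range X. \<Sum>j\<in>range Y. xy i j * ln (xy i j))"
    by (simp only: sum_triple flip: sum_distrib_right xy)
  also have "\<dots> = - entropy_of (\<lambda>x. (X x, Y x))"
    by (simp only: entropy_of_pair[OF X Y] xy_def minus_minus)
  also have "(\<Sum>(i, j, k)\<in>?I. a i j k * ln (yz j k))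
      = (\<Sum>i\<in>range X. \<Sum>p\<in>range Y \<times> range Z. a i (fst p) (snd p) * ln (yz (fst p) (snd p)))"
    by (simp only: sum_triple) (simp add: sum.cartesian_product case_prod_unfold)
  also have "\<dots> = (\<Sum>p\<in>range Y \<times> range Z. \<Sum>i\<in>range X. a i (fst p) (snd p) * ln (yz (fst p) (snd p)))"
    by (rule sum.swap)
  also have "\<dots> = (\<Sum>p\<in>range Y \<times> range Z. yz (fst p) (snd p) * ln (yz (fst p) (snd p)))"
    by (simp only: flip: sum_distrib_right yz)
  also have "\<dots> = (\<Sum>j\<in>range Y. \<Sum>k\<in>range Z. yz j k * ln (yz j k))"
    by (simp only: sum.cartesian_product case_prod_unfold)
  also have "\<dots> = - entropy_of (\<lambda>x. (Y x, Z x))"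
    by (simp only: entropy_of_pair[OF Y Z] yz_def minus_minus)
  also have "(\<Sum>(i, j, k)\<in>?I. a i j k * ln (y j))
      = (\<Sum>i\<in>range X. \<Sum>j\<in>range Y. xy i j * ln (y j))"
    by (simp only: sum_triple flip: sum_distrib_right xy)
  also have "\<dots> = (\<Sum>j\<in>range Y. \<Sum>i\<in>range X. xy i j * ln (y j))" by (rule sum.swap)
  also have "\<dots> = (\<Sum>j\<in>range Y. y j * ln (y j))"
    by (simp only: flip: sum_distrib_right y2)
  also have "\<dots> = - entropy_of Y"
    by (simp only: entropy_of_single[OF Y] y_def minus_minus)
  also have "(\<Sum>(i, j, k)\<in>?I. a i j k * ln (a i j k)) = - entropy_of (\<lambda>x. (X x, Y x, Z x))"
    using fin by (subst partition_entropy_level_sets[of ?I]) (auto simp: a_def case_prod_unfold)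
  finally show ?thesis by simp
qed

lemma entropy_of_const: "entropy_of (\<lambda>_. c) = 0"
  using prob_space by (subst partition_entropy_level_sets[of "{c}"]) (auto simp: space_UNIV)

text \<open>Submodularity with the constant \<open>()\<close> as middle function, whose entropy is
  0.\<close>

lemma entropy_of_subadditive:
  assumes X: "simple_function M X" and Z: "simple_function M Z"
  shows "entropy_of (\<lambda>x. (X x, Z x)) \<le> entropy_of X + entropy_of Z"
proof -
  have "entropy_of (\<lambda>x. (X x, (), Z x)) + entropy_of (\<lambda>_. ())
      \<le> entropy_of (\<lambda>x. (X x, ())) + entropy_of (\<lambda>x. ((), Z x))"
    using X Z by (intro entropy_of_submodular) auto
  moreover have "level_sets (\<lambda>x. (X x, (), Z x)) = level_sets (\<lambda>x. (X x, Z x))"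
    "level_sets (\<lambda>x. (X x, ())) = level_sets X" "level_sets (\<lambda>x. ((), Z x)) = level_sets Z"
    by (auto intro!: level_sets_cong)
  ultimately show ?thesis by (simp add: entropy_of_const)
qed

text \<open>Gibbs' inequality against the conditional law that, given \<open>Y\<close>, puts mass \<open>1 - k * \<alpha>\<close> on the
  prediction \<open>g Y\<close> and \<open>\<alpha>\<close> on each other value.\<close>

lemma fano_inequality:
  assumes X: "simple_function M X" and Y: "simple_function M Y"
    and card: "card (range X) \<le> k" and \<alpha>: "0 < \<alpha>" "real k * \<alpha> < 1"
  shows "entropy_of (\<lambda>x. (X x, Y x))
    \<le> entropy_of Y - ln (1 - real k * \<alpha>) - ln \<alpha> * prob {x. X x \<noteq> g (Y x)}"
proof -
  let ?I = "range X \<times> range Y"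
  define b where "b = 1 - real k * \<alpha>"
  define a where "a i j = prob ((\<lambda>x. (X x, Y x)) -` {(i, j)})" for i j
  define y where "y j = prob (Y -` {j})" for j
  define v where "v i j = (if i = g j then b else \<alpha>)" for i j
  note fin = X[THEN simple_function_finite_range] Y[THEN simple_function_finite_range]
  \<comment> \<open>The range of \<open>X\<close> is nonempty, whence
    \<open>\<alpha> \<le> k * \<alpha> < 1\<close>; so \<open>b\<close> and \<open>\<alpha>\<close>
    lie strictly between 0 and 1.\<close>
  have "k \<ge> 1" using card fin by (cases k) (auto simp: card_eq_0_iff)
  then have "1 * \<alpha> \<le> real k * \<alpha>" using \<alpha> by (intro mult_right_mono) auto
  then have b: "0 < b" "b < 1" "\<alpha> < 1" using \<alpha> unfolding b_def by linarith+
  have a0: "0 \<le> a i j" for i j by (simp add: a_def)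
  have y0: "0 \<le> y j" for j by (simp add: y_def)
  have v0: "0 < v i j" for i j using b \<alpha> by (simp add: v_def)
  have y: "y j = (\<Sum>i\<in>range X. a i j)" for j
    using prob_marginal[OF Y X, of j] by (simp add: y_def a_def vimage_def conj_ac)
  have ypos: "0 < y j" if "0 < a i j" "i \<in> range X" for i j
    unfolding y using that fin a0 by (intro sum_pos2[of _ i]) auto
  \<comment> \<open>The sum may stay below 1, for instance when \<open>g j\<close> lies outside the
    range of \<open>X\<close>. Gibbs' inequality as stated tolerates such a deficit.\<close>
  have sum_v: "(\<Sum>i\<in>range X. v i j) \<le> 1" for j
  proof -
    have "(\<Sum>i\<in>range X. v i j) \<le> (\<Sum>i\<in>range X. (if i = g j then b else 0) + \<alpha>)"
      using b \<alpha> by (intro sum_mono) (auto simp: v_def)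
    also have "\<dots> \<le> b + real (card (range X)) * \<alpha>"
      using fin b by (simp add: sum.distrib sum.delta)
    also have "\<dots> \<le> b + real k * \<alpha>" using card \<alpha> by (intro add_left_mono mult_right_mono) auto
    finally show ?thesis by (simp add: b_def)
  qed
  have "(\<Sum>(i, j)\<in>?I. y j * v i j) = (\<Sum>j\<in>range Y. y j * (\<Sum>i\<in>range X. v i j))"
    by (subst sum.cartesian_product[symmetric], subst sum.swap) (simp only: sum_distrib_left)
  also have "\<dots> \<le> (\<Sum>j\<in>range Y. y j * 1)"
    using sum_v y0 by (intro sum_mono mult_left_mono) auto
  also have "\<dots> = (\<Sum>(i, j)\<in>?I. a i j)"
    by (subst sum.cartesian_product[symmetric], subst sum.swap) (simp only: y mult_1_right)
  finally have sum_le: "(\<Sum>(i, j)\<in>?I. y j * v i j) \<le> (\<Sum>(i, j)\<in>?I. a i j)" .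
  have "(\<Sum>p\<in>?I. (case p of (i, j) \<Rightarrow> a i j) * ln (case p of (i, j) \<Rightarrow> y j * v i j))
      \<le> (\<Sum>p\<in>?I. (case p of (i, j) \<Rightarrow> a i j) * ln (case p of (i, j) \<Rightarrow> a i j))"
  proof (rule gibbs_inequality)
    fix p assume "p \<in> ?I"
    then obtain i j where p: "p = (i, j)" "i \<in> range X" by (cases p) auto
    show "0 \<le> (case p of (i, j) \<Rightarrow> a i j)" by (simp add: p a0)
    show "0 \<le> (case p of (i, j) \<Rightarrow> y j * v i j)" using y0 v0 by (simp add: p less_imp_le)
    assume "0 < (case p of (i, j) \<Rightarrow> a i j)"
    then have "0 < a i j" by (simp add: p)
    from ypos[OF this p(2)] show "0 < (case p of (i, j) \<Rightarrow> y j * v i j)" using v0 by (simp add: p)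
  qed (rule sum_le)
  then have "(\<Sum>(i, j)\<in>?I. a i j * ln (y j * v i j)) \<le> (\<Sum>(i, j)\<in>?I. a i j * ln (a i j))"
    by (simp add: case_prod_unfold)
  also have "(\<Sum>(i, j)\<in>?I. a i j * ln (a i j)) = - entropy_of (\<lambda>x. (X x, Y x))"
    by (simp only: entropy_of_pair[OF X Y] a_def minus_minus sum.cartesian_product)
  also have "(\<Sum>(i, j)\<in>?I. a i j * ln (y j * v i j))
      = (\<Sum>(i, j)\<in>?I. a i j * ln (y j) + a i j * ln (v i j))"
  proof (intro sum.cong refl, clarify)
    fix i j
    show "a (X i) (Y j) * ln (y (Y j) * v (X i) (Y j))
      = a (X i) (Y j) * ln (y (Y j)) + a (X i) (Y j) * ln (v (X i) (Y j))"
    proof (cases "a (X i) (Y j) = 0")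
      case False
      then have "0 < a (X i) (Y j)" using a0[of "X i" "Y j"] by linarith
      from ypos[OF this] v0[of "X i" "Y j"] show ?thesis by (simp add: ln_mult ring_distribs)
    qed simp
  qed
  also have "\<dots> = (\<Sum>(i, j)\<in>?I. a i j * ln (y j)) + (\<Sum>(i, j)\<in>?I. a i j * ln (v i j))"
    by (simp add: sum.distrib case_prod_unfold)
  also have "(\<Sum>(i, j)\<in>?I. a i j * ln (y j)) = (\<Sum>j\<in>range Y. y j * ln (y j))"
    by (subst sum.cartesian_product[symmetric], subst sum.swap)
      (simp only: flip: sum_distrib_right y)
  also have "\<dots> = - entropy_of Y"
    by (simp only: entropy_of_single[OF Y] y_def minus_minus)
  finally have main: "entropy_of (\<lambda>x. (X x, Y x)) + (\<Sum>(i, j)\<in>?I. a i j * ln (v i j)) \<le> entropy_of Y"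
    by simp
  define J where "J = {p \<in> ?I. fst p \<noteq> g (snd p)}"
  have "prob {x. X x \<noteq> g (Y x)} = prob (\<Union>p\<in>J. (\<lambda>x. (X x, Y x)) -` {p})"
    by (rule arg_cong[of _ _ prob]) (auto simp: J_def)
  also have "\<dots> = (\<Sum>p\<in>J. prob ((\<lambda>x. (X x, Y x)) -` {p}))"
    using fin X Y by (intro finite_measure_finite_Union)
      (auto simp: J_def disjoint_family_on_def intro!: simple_function_vimage_sets)
  also have "\<dots> = (\<Sum>p\<in>?I. if fst p \<noteq> g (snd p) then prob ((\<lambda>x. (X x, Y x)) -` {p}) else 0)"
    unfolding J_def using fin by (intro sum.inter_filter) auto
  finally have err: "prob {x. X x \<noteq> g (Y x)} = (\<Sum>(i, j)\<in>?I. if i \<noteq> g j then a i j else 0)"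
    by (simp add: a_def case_prod_unfold cong: if_cong)
  have "(\<Sum>(i, j)\<in>?I. a i j) = (\<Sum>j\<in>range Y. y j)"
    by (subst sum.cartesian_product[symmetric], subst sum.swap) (intro sum.cong refl y[symmetric])
  then have one: "(\<Sum>(i, j)\<in>?I. a i j) = 1"
    using sum_prob_range[OF Y] by (simp only: y_def)
  have "ln b + ln \<alpha> * prob {x. X x \<noteq> g (Y x)}
      = (\<Sum>(i, j)\<in>?I. a i j * ln b + (if i \<noteq> g j then a i j else 0) * ln \<alpha>)"
    unfolding err using one
    by (simp add: case_prod_unfold sum.distrib flip: sum_distrib_right)
  \<comment> \<open>Where the prediction is right both sides agree. Where it is wrong the left has
    the extra term \<open>a i j * ln b\<close>, which is nonpositive since
    \<open>b < 1\<close>.\<close>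
  also have "\<dots> \<le> (\<Sum>(i, j)\<in>?I. a i j * ln (v i j))"
    using a0 b by (intro sum_mono) (auto simp: v_def mult_nonneg_nonpos)
  finally show ?thesis using main by (simp add: b_def)
qed

text \<open>Each of the two error terms in Fano's inequality gets half of \<open>e\<close>. The
  order of quantifiers matters: \<open>\<eta>\<close> depends on \<open>e\<close> and
  \<open>k\<close> alone, hence serves all \<open>X\<close>, \<open>Y\<close> and predictions
  \<open>g\<close> at once.\<close>

lemma entropy_of_approx:
  assumes "0 < e"
  shows "\<exists>\<eta>>0. \<forall>(X::'a \<Rightarrow> 'i) (Y::'a \<Rightarrow> 'j) g. simple_function M X \<longrightarrow> simple_function M Y \<longrightarrow>
    card (range X) \<le> k \<longrightarrow> prob {x. X x \<noteq> g (Y x)} \<le> \<eta> \<longrightarrow>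
    entropy_of (\<lambda>x. (X x, Y x)) \<le> entropy_of Y + e"
proof -
  \<comment> \<open>Chosen so that \<open>k * \<alpha> \<le> 1 - exp (- e / 2)\<close>, which bounds
    \<open>- ln (1 - k * \<alpha>)\<close> by \<open>e / 2\<close>; the denominator is positive also
    for \<open>k = 0\<close>.\<close>
  define \<alpha> where "\<alpha> = (1 - exp (- e / 2)) / (real k + 1)"
  \<comment> \<open>As \<open>ln \<alpha> \<le> 0\<close>, the denominator is positive and exceeds
    \<open>- ln \<alpha>\<close>, so the error probability costs at most
    \<open>e / 2\<close>.\<close>
  define \<eta> where "\<eta> = e / 2 / (1 - ln \<alpha>)"
  have e1: "0 < 1 - exp (- e / 2)" "1 - exp (- e / 2) < 1" using assms by auto
  have \<alpha>0: "0 < \<alpha>" using e1 by (simp add: \<alpha>_def)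
  have "real k * \<alpha> \<le> (real k + 1) * \<alpha>" using \<alpha>0 by (intro mult_right_mono) auto
  also have "\<dots> = 1 - exp (- e / 2)" by (simp add: \<alpha>_def)
  finally have ka: "real k * \<alpha> \<le> 1 - exp (- e / 2)" .
  then have ka1: "real k * \<alpha> < 1" using e1 by linarith
  have "\<alpha> \<le> 1 - exp (- e / 2)"
    using divide_left_mono[of 1 "real k + 1" "1 - exp (- e / 2)"] e1 by (simp add: \<alpha>_def)
  then have "\<alpha> \<le> 1" using e1 by linarith
  then have ln\<alpha>: "ln \<alpha> \<le> 0" using \<alpha>0 by simp
  have "ln (exp (- e / 2)) \<le> ln (1 - real k * \<alpha>)"
    using ka by (intro ln_mono exp_gt_zero) linarith
  then have 1: "- ln (1 - real k * \<alpha>) \<le> e / 2" by simp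
  have \<eta>0: "0 < \<eta>" using assms ln\<alpha> by (simp add: \<eta>_def)
  have 2: "- ln \<alpha> * \<eta> \<le> e / 2" using assms ln\<alpha> by (simp add: \<eta>_def field_simps)
  show ?thesis
  proof (intro exI[of _ \<eta>] conjI \<eta>0 allI impI)
    fix X :: "'a \<Rightarrow> 'i" and Y :: "'a \<Rightarrow> 'j" and g
    assume *: "simple_function M X" "simple_function M Y" "card (range X) \<le> k"
      "prob {x. X x \<noteq> g (Y x)} \<le> \<eta>"
    have "- ln \<alpha> * prob {x. X x \<noteq> g (Y x)} \<le> - ln \<alpha> * \<eta>"
      using * ln\<alpha> by (intro mult_left_mono) auto
    with 2 have 3: "- ln \<alpha> * prob {x. X x \<noteq> g (Y x)} \<le> e / 2" by linarith
    show "entropy_of (\<lambda>x. (X x, Y x)) \<le> entropy_of Y + e"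
      using fano_inequality[OF *(1-3) \<alpha>0 ka1, of g] 1 3 by linarith
  qed
qed


lemma entropy_of_preserving:
  assumes X: "simple_function M X" and T: "T \<in> measurable M M" "distr M M T = M"
  shows "entropy_of (\<lambda>x. X (T x)) = entropy_of X"
proof -
  have "prob ((\<lambda>x. X (T x)) -` {i}) = prob (X -` {i})" for i
  proof -
    have "measure (distr M M T) (X -` {i}) = prob (T -` (X -` {i}) \<inter> space M)"
      using X T by (intro measure_distr) (auto intro: simple_function_vimage_sets)
    then show ?thesis using T by (simp add: space_UNIV vimage_def)
  qed
  then show ?thesis
    using X simple_function_finite_range[OF X]
    by (simp add: partition_entropy_level_sets[of "range X"] image_subset_iff)
qed

end

section \<open>Itineraries and entropy rates along orbits\<close>

definition itinerary :: "(nat \<Rightarrow> 'a \<Rightarrow> 'i) \<Rightarrow> nat \<Rightarrow> 'a \<Rightarrow> 'i list" where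
  "itinerary X n x = map (\<lambda>i. X i x) [0..<n]"

lemma itinerary_Suc: "itinerary X (Suc n) x = itinerary X n x @ [X n x]"
  by (simp add: itinerary_def)

lemma itinerary_eq_iff: "itinerary X n x = itinerary X n y \<longleftrightarrow> (\<forall>i<n. X i x = X i y)"
  by (auto simp: itinerary_def)

lemma itinerary_add:
  "itinerary (\<lambda>i x. X ((T ^^ i) x)) (m + n) x
    = itinerary (\<lambda>i x. X ((T ^^ i) x)) m x @ itinerary (\<lambda>i x. X ((T ^^ i) x)) n ((T ^^ m) x)"
proof (induction n)
  case (Suc n)
  then show ?case
    by (simp add: itinerary_Suc funpow_add[of n m] add.commute[of m n])
qed (simp add: itinerary_def)

context full_prob_space
begin

lemma simple_function_itinerary:
  assumes "\<And>i. simple_function M (X i)"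
  shows "simple_function M (itinerary X n)"
proof (induction n)
  case 0
  then show ?case by (simp add: itinerary_def)
next
  case (Suc n)
  have "itinerary X (Suc n) = (\<lambda>x. itinerary X n x @ [X n x])"
    by (simp add: fun_eq_iff itinerary_Suc)
  then show ?case
    using simple_function_compose2[OF Suc.IH assms[of n], of "\<lambda>xs x. xs @ [x]"] by simp
qed

text \<open>Each summand is the conditional entropy of \<open>X i\<close> given \<open>Y i\<close>.
  The induction step discards the past from the conditioning, which can only raise a conditional
  entropy.\<close>

lemma entropy_of_itinerary_le:
  assumes X: "\<And>i. simple_function M (X i)" and Y: "\<And>i. simple_function M (Y i)"
  shows "entropy_of (\<lambda>x. (itinerary X n x, itinerary Y n x))
    \<le> entropy_of (itinerary Y n) + (\<Sum>i<n. entropy_of (\<lambda>x. (X i x, Y i x)) - entropy_of (Y i))"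
proof (induction n)
  case 0
  then show ?case by (simp add: itinerary_def entropy_of_const)
next
  case (Suc n)
  let ?A = "itinerary X n" and ?B = "itinerary Y n"
  note sf = X[of n] Y[of n] simple_function_itinerary[of X n, OF X] simple_function_itinerary[of Y n, OF Y]
  \<comment> \<open>Drops the past of \<open>X\<close>: the new pair is conditioned on the past of
    \<open>Y\<close> alone.\<close>
  have "entropy_of (\<lambda>x. (?A x, ?B x, (X n x, Y n x))) + entropy_of ?B
      \<le> entropy_of (\<lambda>x. (?A x, ?B x)) + entropy_of (\<lambda>x. (?B x, (X n x, Y n x)))"
    by (intro entropy_of_submodular simple_function_Pair sf)
  \<comment> \<open>Drops the past of \<open>Y\<close> as well: \<open>X n\<close> is now
    conditioned on \<open>Y n\<close> only.\<close>
  moreover have "entropy_of (\<lambda>x. (?B x, Y n x, X n x)) + entropy_of (Y n)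
      \<le> entropy_of (\<lambda>x. (?B x, Y n x)) + entropy_of (\<lambda>x. (Y n x, X n x))"
    by (intro entropy_of_submodular sf)
  moreover have
    "level_sets (\<lambda>x. (itinerary X (Suc n) x, itinerary Y (Suc n) x))
      = level_sets (\<lambda>x. (?A x, ?B x, (X n x, Y n x)))"
    "level_sets (itinerary Y (Suc n)) = level_sets (\<lambda>x. (?B x, Y n x))"
    "level_sets (\<lambda>x. (?B x, (X n x, Y n x))) = level_sets (\<lambda>x. (?B x, Y n x, X n x))"
    "level_sets (\<lambda>x. (Y n x, X n x)) = level_sets (\<lambda>x. (X n x, Y n x))"
    by (intro level_sets_cong; auto simp: itinerary_Suc)+
  ultimately show ?case using Suc.IH by simp
qed

lemma funpow_preserving:
  assumes T: "T \<in> measurable M M" "distr M M T = M"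
  shows "T ^^ n \<in> measurable M M \<and> distr M M (T ^^ n) = M"
proof (induction n)
  case 0
  then show ?case by (simp add: id_def distr_id)
next
  case (Suc n)
  then show ?case
    using T distr_distr[of T M M "T ^^ n" M]
    by (metis funpow.simps(2) comp_apply measurable_comp)
qed

text \<open>The itinerary of length \<open>m + n\<close> splits into one of length \<open>m\<close>
  and one of length \<open>n\<close> started at time \<open>m\<close>. By invariance the latter has
  the entropy of an unshifted one, so Fekete's lemma applies.\<close>

lemma convergent_entropy_rate:
  assumes X: "simple_function M X" and T: "T \<in> measurable M M" "distr M M T = M"
  shows "convergent (\<lambda>n. entropy_of (itinerary (\<lambda>i x. X ((T ^^ i) x)) n) / real n)"
proof (rule fekete)
  fix m n
  let ?I = "itinerary (\<lambda>i x. X ((T ^^ i) x))"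
  have TT: "T ^^ i \<in> measurable M M" "distr M M (T ^^ i) = M" for i
    using funpow_preserving[OF T] by auto
  have sf: "simple_function M (?I k)" for k
    by (intro simple_function_itinerary simple_function_comp[OF TT(1) X])
  have "level_sets (?I (m + n)) = level_sets (\<lambda>x. (?I m x, ?I n ((T ^^ m) x)))"
  proof (rule level_sets_cong)
    have "length (?I m x) = length (?I m y)" for x y by (simp add: itinerary_def)
    then show "?I (m + n) x = ?I (m + n) y \<longleftrightarrow>
        (?I m x, ?I n ((T ^^ m) x)) = (?I m y, ?I n ((T ^^ m) y))" for x y
      by (simp add: itinerary_add)
  qed
  moreover have "entropy_of (\<lambda>x. (?I m x, ?I n ((T ^^ m) x)))
      \<le> entropy_of (?I m) + entropy_of (\<lambda>x. ?I n ((T ^^ m) x))"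
    by (intro entropy_of_subadditive sf simple_function_comp[OF TT(1) sf])
  ultimately show "entropy_of (?I (m + n)) \<le> entropy_of (?I m) + entropy_of (?I n)"
    using entropy_of_preserving[OF sf TT] by simp
qed (rule partition_entropy_nonneg)

end

section \<open>Partitions\<close>

text \<open>Turns a partition of the whole type into a function whose fibres are the cells.\<close>

definition cell :: "'a set set \<Rightarrow> 'a \<Rightarrow> 'a set" where
  "cell P x = (THE A. A \<in> P \<and> x \<in> A)"

lemma cell_eqI:
  assumes "partition_on UNIV P" "A \<in> P" "x \<in> A"
  shows "cell P x = A"
proof -
  have "B = A" if "B \<in> P" "x \<in> B" for B
  proof (rule ccontr)
    assume "B \<noteq> A"
    then have "B \<inter> A = {}" by (rule disjointD[OF partition_onD2[OF assms(1)] that(1) assms(2)])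
    then show False using that assms(3) by blast
  qed
  then show ?thesis unfolding cell_def using assms(2,3)
    by (intro the_equality) blast+
qed

lemma cell_mem:
  assumes "partition_on UNIV P"
  shows "cell P x \<in> P" "x \<in> cell P x"
proof -
  have "x \<in> \<Union>P" using partition_onD1[OF assms] by (metis UNIV_I)
  then obtain A where "A \<in> P" "x \<in> A" by (rule UnionE)
  then show "cell P x \<in> P" "x \<in> cell P x" using cell_eqI[OF assms, of A x] by simp_all
qed

lemma cell_eq_iff:
  assumes "partition_on UNIV P"
  shows "cell P x = cell P y \<longleftrightarrow> x \<in> cell P y"
  using cell_mem(2)[OF assms, of x] cell_eqI[OF assms cell_mem(1)[OF assms], of x y] by auto

lemma range_cell:
  assumes "partition_on UNIV P"
  shows "range (cell P) \<subseteq> P"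
  using cell_mem[OF assms] by auto

lemma partition_on_preimage_partition:
  assumes "partition_on UNIV P"
  shows "partition_on UNIV (preimage_partition g P)"
  using partition_on_vimage[OF assms, of g] by (simp add: preimage_partition_def)

lemma cell_preimage_partition:
  assumes "partition_on UNIV P"
  shows "cell (preimage_partition g P) x = g -` cell P (g x)"
  using cell_mem[OF assms, of "g x"]
  by (intro cell_eqI partition_on_preimage_partition assms) (auto simp: preimage_partition_def)

text \<open>The two functions differ in their values but have the same kernel, so they may be
  exchanged inside \<open>level_sets\<close>.\<close>

lemma cell_preimage_partition_eq_iff:
  assumes "partition_on UNIV P"
  shows "cell (preimage_partition g P) x = cell (preimage_partition g P) y
    \<longleftrightarrow> cell P (g x) = cell P (g y)"
  unfolding cell_eq_iff[OF partition_on_preimage_partition[OF assms]]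
  by (simp add: cell_preimage_partition cell_eq_iff assms)

text \<open>A nonempty cell of the refinement is determined by any of its points \<open>x\<close>:
  the cell chosen from each partition must be the one containing \<open>x\<close>. Repetitions among
  the \<open>R i\<close> do no harm, as \<open>cell\<close> depends on the partition and not on its
  index.\<close>

lemma common_refinement_eq_level_sets:
  assumes R: "\<And>i. i < n \<Longrightarrow> partition_on UNIV (R i)"
  shows "common_refinement (R ` {..<n}) = level_sets (itinerary (\<lambda>i. cell (R i)) n)"
proof -
  have level: "{y. itinerary (\<lambda>i. cell (R i)) n y = itinerary (\<lambda>i. cell (R i)) n x}
      = \<Inter> ((\<lambda>P. cell P x) ` R ` {..<n})" for x
    using R by (auto simp: itinerary_eq_iff cell_eq_iff)
  show ?thesis unfolding level_sets_alt
  proof safe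
    fix A assume "A \<in> common_refinement (R ` {..<n})"
    then obtain h where h: "h \<in> (\<Pi> P\<in>R ` {..<n}. P)" and A: "A = \<Inter> (h ` R ` {..<n})" and "A \<noteq> {}"
      by (auto simp: common_refinement)
    then obtain x where x: "x \<in> A" by auto
    have "h P = cell P x" if "P \<in> R ` {..<n}" for P
      using that h A x R by (intro cell_eqI[symmetric]) auto
    then have "A = \<Inter> ((\<lambda>P. cell P x) ` R ` {..<n})" unfolding A by simp
    then show "A \<in> range (\<lambda>x. {y. itinerary (\<lambda>i. cell (R i)) n y = itinerary (\<lambda>i. cell (R i)) n x})"
      unfolding level by (rule range_eqI)
  next
    fix x
    have "(\<lambda>P. cell P x) \<in> (\<Pi> P\<in>R ` {..<n}. P)" using R by (auto intro: cell_mem)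
    moreover have "x \<in> \<Inter> ((\<lambda>P. cell P x) ` R ` {..<n})" using R by (auto intro: cell_mem)
    ultimately show "{y. itinerary (\<lambda>i. cell (R i)) n y = itinerary (\<lambda>i. cell (R i)) n x}
        \<in> common_refinement (R ` {..<n})"
      unfolding level common_refinement by blast
  qed
qed

lemma orbit_map_const: "orbit_map (\<lambda>_. f) i = f ^^ i"
  by (induction i) auto

lemma orbit_join_const_eq_level_sets:
  assumes P: "\<And>i. partition_on UNIV (P i)"
  shows "orbit_join (\<lambda>_. f) P n = level_sets (itinerary (\<lambda>i x. cell (P i) ((f ^^ i) x)) n)"
proof -
  have "orbit_join (\<lambda>_. f) P n
      = level_sets (itinerary (\<lambda>i. cell (preimage_partition (f ^^ i) (P i))) n)"
    unfolding orbit_join_def orbit_map_const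
    by (intro common_refinement_eq_level_sets partition_on_preimage_partition P)
  also have "\<dots> = level_sets (itinerary (\<lambda>i x. cell (P i) ((f ^^ i) x)) n)"
    by (intro level_sets_cong) (simp add: itinerary_eq_iff cell_preimage_partition_eq_iff P)
  finally show ?thesis .
qed

lemma simple_function_cell:
  fixes M :: "'a::topological_space measure"
  assumes "sets M = sets borel" "finite_borel_partition P"
  shows "simple_function M (cell P)"
proof -
  have P: "finite P" "partition_on UNIV P" "P \<subseteq> sets borel"
    using assms by (auto simp: finite_borel_partition_def)
  have "space M = UNIV" using sets_eq_imp_space_eq[OF assms(1)] by simp
  moreover have "cell P -` {cell P x} = cell P x" for x
    using P by (auto simp: cell_eq_iff)
  moreover have "finite (range (cell P))" using range_cell[OF P(2)] P(1) by (rule finite_subset)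
  ultimately show ?thesis
    using P assms cell_mem(1)[OF P(2)] by (auto simp: simple_function_def)
qed

lemma partition_on_level_sets: "partition_on UNIV (level_sets X)"
  by (rule partition_onI) (auto simp: level_sets_def disjnt_def)

text \<open>Points are sorted by which balls of a finite cover contain them. Points of one class
  share a ball of radius \<open>\<delta> / 2\<close>.\<close>

lemma exists_fine_partition:
  assumes "compact (UNIV :: 'a::metric_space set)" "0 < \<delta>"
  shows "\<exists>P::'a set set. finite_borel_partition P \<and> (\<forall>A\<in>P. \<forall>x\<in>A. \<forall>y\<in>A. dist x y < \<delta>)"
proof -
  obtain C :: "'a set" where C: "finite C" "UNIV \<subseteq> (\<Union>c\<in>C. ball c (\<delta> / 2))"
    using seq_compact_imp_totally_bounded[OF compact_imp_seq_compact[OF assms(1)]] assms(2)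
    by (meson half_gt_zero)
  define X where "X x = {c \<in> C. x \<in> ball c (\<delta> / 2)}" for x
  have "X -` {X x} = (\<Inter>c\<in>X x. ball c (\<delta> / 2)) \<inter> (\<Inter>c\<in>C - X x. - ball c (\<delta> / 2))" for x
    unfolding X_def by blast
  moreover have "(\<Inter>c\<in>X x. ball c (\<delta> / 2)) \<inter> (\<Inter>c\<in>C - X x. - ball c (\<delta> / 2)) \<in> sets borel" for x
  proof (intro sets.Int[OF borel_open borel_closed] open_INT closed_INT)
    show "finite (X x)" using C(1) by (simp add: X_def)
  qed (auto simp: closed_Compl)
  ultimately have "level_sets X \<subseteq> sets borel" by (auto simp: level_sets_def)
  moreover have "range X \<subseteq> Pow C" by (auto simp: X_def)
  then have "finite (level_sets X)"
    unfolding level_sets_def using C(1) by (meson finite_imageI finite_subset finite_Pow_iff)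
  ultimately have "finite_borel_partition (level_sets X)"
    by (simp add: finite_borel_partition_def partition_on_level_sets)
  moreover have "dist x y < \<delta>" if "X x = X y" for x y
  proof -
    obtain c where "c \<in> C" "x \<in> ball c (\<delta> / 2)" using C(2) by blast
    then have "c \<in> X x" by (simp add: X_def)
    then have "dist c x < \<delta> / 2" "dist c y < \<delta> / 2" using that by (auto simp: X_def)
    then show ?thesis by (rule dist_triangle_half_r)
  qed
  then have "\<forall>A\<in>level_sets X. \<forall>x\<in>A. \<forall>y\<in>A. dist x y < \<delta>" by (auto simp: level_sets_def)
  ultimately show ?thesis by blast
qed

section \<open>Admissible sequences\<close>

text \<open>The distance to \<open>T\<close> attains its minimum on the compact set
  \<open>S\<close>, and it is positive there because \<open>T\<close> is closed and misses
  \<open>S\<close>.\<close>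

lemma compact_closed_separation:
  fixes S T :: "'a::metric_space set"
  assumes "compact S" "closed T" "S \<inter> T = {}"
  shows "\<exists>d>0. \<forall>x\<in>S. \<forall>y\<in>T. d \<le> dist x y"
proof (cases "S = {} \<or> T = {}")
  case True
  then show ?thesis by (intro exI[of _ 1]) auto
next
  case False
  then obtain x where x: "x \<in> S" "\<And>z. z \<in> S \<Longrightarrow> infdist x T \<le> infdist z T"
    using continuous_attains_inf[OF assms(1) _ continuous_on_infdist[OF continuous_on_id]]
    by metis
  have "x \<notin> T" using assms(3) x(1) by blast
  then have "infdist x T \<noteq> 0" using False in_closed_iff_infdist_zero[OF assms(2)] by blast
  then have "0 < infdist x T" using infdist_nonneg[of x T] by linarith
  moreover have "infdist x T \<le> dist z y" if "z \<in> S" "y \<in> T" for z y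
    using x(2)[OF that(1)] infdist_le[OF that(2), of z] by linarith
  ultimately show ?thesis by blast
qed

lemma finite_common_separation:
  fixes K :: "'i \<Rightarrow> 'a::metric_space set"
  assumes "finite I" and K: "\<And>i. i \<in> I \<Longrightarrow> compact (K i)"
    and disj: "\<And>i j. i \<in> I \<Longrightarrow> j \<in> I \<Longrightarrow> i \<noteq> j \<Longrightarrow> K i \<inter> K j = {}"
  shows "\<exists>\<delta>>0. \<forall>i\<in>I. \<forall>j\<in>I. i \<noteq> j \<longrightarrow> (\<forall>x\<in>K i. \<forall>y\<in>K j. \<delta> \<le> dist x y)"
proof -
  have "\<forall>p\<in>I \<times> I. \<exists>\<delta>>0. fst p \<noteq> snd p \<longrightarrow> (\<forall>x\<in>K (fst p). \<forall>y\<in>K (snd p). \<delta> \<le> dist x y)"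
  proof
    fix p assume "p \<in> I \<times> I"
    then show "\<exists>\<delta>>0. fst p \<noteq> snd p \<longrightarrow> (\<forall>x\<in>K (fst p). \<forall>y\<in>K (snd p). \<delta> \<le> dist x y)"
      using compact_closed_separation[of "K (fst p)" "K (snd p)"] K disj
      by (cases "fst p = snd p") (auto simp: compact_imp_closed intro: exI[of _ 1])
  qed
  then obtain d where d: "\<And>p. p \<in> I \<times> I \<Longrightarrow> 0 < d p"
    "\<And>p x y. p \<in> I \<times> I \<Longrightarrow> fst p \<noteq> snd p \<Longrightarrow> x \<in> K (fst p) \<Longrightarrow> y \<in> K (snd p) \<Longrightarrow> d p \<le> dist x y"
    by metis
  \<comment> \<open>The extra 1 keeps the set nonempty when \<open>I\<close> is empty.\<close>
  let ?\<delta> = "Min (insert 1 (d ` (I \<times> I)))"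
  have "0 < ?\<delta>" using d(1) assms(1) by (subst Min_gr_iff) auto
  moreover have "?\<delta> \<le> dist x y" if "i \<in> I" "j \<in> I" "i \<noteq> j" "x \<in> K i" "y \<in> K j" for i j x y
  proof -
    have "?\<delta> \<le> d (i, j)" using that assms(1) by (intro Min_le) auto
    also have "\<dots> \<le> dist x y" using d(2)[of "(i, j)"] that by auto
    finally show ?thesis .
  qed
  ultimately show ?thesis by blast
qed

lemma admissible_partitionsE:
  fixes \<mu> :: "nat \<Rightarrow> 'a::metric_space measure"
  assumes "P \<in> admissible_partitions \<mu>" "0 < \<epsilon>"
  obtains \<delta> K where "0 < \<delta>"
    "\<And>n A. A \<in> P n \<Longrightarrow> compact (K n A)" "\<And>n A. A \<in> P n \<Longrightarrow> K n A \<subseteq> A"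
    "\<And>n A. A \<in> P n \<Longrightarrow> measure (\<mu> n) (A - K n A) \<le> \<epsilon>"
    "\<And>n A B x y. A \<in> P n \<Longrightarrow> B \<in> P n \<Longrightarrow> A \<noteq> B \<Longrightarrow> x \<in> K n A \<Longrightarrow> y \<in> K n B
      \<Longrightarrow> \<delta> \<le> dist x y"
proof -
  define S where "S \<epsilon> \<delta> K \<longleftrightarrow> (\<forall>n.
      (\<forall>A\<in>P n. compact (K n A) \<and> K n A \<subseteq> A \<and> measure (\<mu> n) (A - K n A) \<le> \<epsilon>) \<and>
      (\<forall>A\<in>P n. \<forall>B\<in>P n. A \<noteq> B \<longrightarrow> (\<forall>x\<in>K n A. \<forall>y\<in>K n B. dist x y \<ge> \<delta>)))"
    for \<epsilon> \<delta> :: real and K :: "nat \<Rightarrow> 'a set \<Rightarrow> 'a set"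
  have "\<forall>\<epsilon>>0. \<exists>\<delta>>0. \<exists>K. S \<epsilon> \<delta> K"
    using assms(1) unfolding admissible_partitions_def S_def by (elim CollectE conjE)
  then obtain \<delta> K where "0 < \<delta>" "S \<epsilon> \<delta> K" using assms(2) by blast
  then show thesis by (intro that[of \<delta> K]) (simp_all add: S_def)
qed

lemma const_admissible:
  fixes M :: "'a::metric_space measure"
  assumes compact: "compact (UNIV :: 'a set)" and fm: "finite_measure M"
    and M: "sets M = sets borel" and P: "finite_borel_partition P"
  shows "(\<lambda>_. P) \<in> admissible_partitions (\<lambda>_. M)"
proof -
  interpret finite_measure M by (rule fm)
  have P': "finite P" "partition_on UNIV P" "P \<subseteq> sets borel"
    using P by (auto simp: finite_borel_partition_def)
  define S where "S \<epsilon> \<delta> K \<longleftrightarrow> (\<forall>A\<in>P. compact (K A) \<and> K A \<subseteq> A \<and> measure M (A - K A) \<le> \<epsilon>) \<and>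
      (\<forall>A\<in>P. \<forall>B\<in>P. A \<noteq> B \<longrightarrow> (\<forall>x\<in>K A. \<forall>y\<in>K B. dist x y \<ge> \<delta>))" for \<epsilon> \<delta> K
  have fixed: "\<exists>\<delta>>0. \<exists>K. S \<epsilon> \<delta> K" if "0 < \<epsilon>" for \<epsilon>
  proof -
    have "\<forall>A\<in>P. \<exists>F. compact F \<and> F \<subseteq> A \<and> measure M (A - F) \<le> \<epsilon>"
    proof
      fix A assume "A \<in> P"
      then have A: "A \<in> sets borel" using P' by auto
      obtain F U where F: "closed F" "open U" "F \<subseteq> A" "A \<subseteq> U" "measure M (U - F) < \<epsilon>"
        using borel_closed_open_approx[OF fm M A \<open>0 < \<epsilon>\<close>] by blast
      have "measure M (A - F) \<le> measure M (U - F)"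
        using F M by (intro finite_measure_mono) auto
      moreover have "compact F" using compact_Int_closed[OF compact F(1)] by simp
      ultimately show "\<exists>F. compact F \<and> F \<subseteq> A \<and> measure M (A - F) \<le> \<epsilon>"
        using F by (intro exI[of _ F]) auto
    qed
    then obtain K where K: "\<forall>A\<in>P. compact (K A) \<and> K A \<subseteq> A \<and> measure M (A - K A) \<le> \<epsilon>"
      by metis
    have "K A \<inter> K B = {}" if "A \<in> P" "B \<in> P" "A \<noteq> B" for A B
      using K that disjointD[OF partition_onD2[OF P'(2)], of A B] by blast
    then obtain \<delta> where "0 < \<delta>"
      "\<forall>A\<in>P. \<forall>B\<in>P. A \<noteq> B \<longrightarrow> (\<forall>x\<in>K A. \<forall>y\<in>K B. \<delta> \<le> dist x y)"
      using finite_common_separation[OF P'(1), of K] K by blast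
    then show ?thesis
      using K by (intro exI[of _ \<delta>] exI[of _ K] conjI) (simp_all add: S_def)
  qed
  \<comment> \<open>One choice of \<open>\<delta>\<close> and \<open>K\<close> for the single
    partition \<open>P\<close> serves every index, which gives the uniformity in
    \<open>n\<close>.\<close>
  have "\<forall>\<epsilon>>0. \<exists>\<delta>>0. \<exists>K :: nat \<Rightarrow> 'a set \<Rightarrow> 'a set. \<forall>n. S \<epsilon> \<delta> (K n)"
  proof (intro allI impI)
    fix \<epsilon> :: real assume "0 < \<epsilon>"
    from fixed[OF this] obtain \<delta> K where "0 < \<delta>" "S \<epsilon> \<delta> K" by blast
    then show "\<exists>\<delta>>0. \<exists>K :: nat \<Rightarrow> 'a set \<Rightarrow> 'a set. \<forall>n. S \<epsilon> \<delta> (K n)"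
      by (intro exI[of _ \<delta>] exI[of _ "\<lambda>_. K"] conjI allI)
  qed
  moreover have "\<exists>k. \<forall>n::nat. card P \<le> k" by blast
  ultimately show ?thesis
    using P unfolding admissible_partitions_def S_def by (intro CollectI conjI) simp_all
qed

section \<open>Comparison of the nonautonomous entropy with the classical one\<close>

locale compact_full_prob_space = full_prob_space M for M :: "'a::metric_space measure" +
  assumes sets_borel: "sets M = sets borel" and compact_UNIV: "compact (UNIV :: 'a set)"
begin

text \<open>A cell of diameter less than \<open>\<delta>\<close> meets at most one of the \<open>\<delta>\<close>-separated sets \<open>K n A\<close>, so
  the cell of \<open>Q\<close> predicts the cell of each \<open>P n\<close> up to a small error.\<close>

lemma admissible_uniform_approx:
  assumes P: "P \<in> admissible_partitions (\<lambda>_. M)" and "0 < e"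
  shows "\<exists>Q. finite_borel_partition Q \<and>
    (\<forall>n. entropy_of (\<lambda>x. (cell (P n) x, cell Q x)) \<le> entropy_of (cell Q) + e)"
proof -
  have fbp: "finite_borel_partition (P n)" for n using P by (auto simp: admissible_partitions_def)
  then have Pn: "finite (P n)" "partition_on UNIV (P n)" "P n \<subseteq> sets borel" for n
    by (auto simp: finite_borel_partition_def)
  obtain k where k: "\<And>n. card (P n) \<le> k" using P by (auto simp: admissible_partitions_def)
  obtain \<eta> where \<eta>: "0 < \<eta>"
    and approx: "\<And>(X::'a \<Rightarrow> 'a set) (Y::'a \<Rightarrow> 'a set) g. simple_function M X \<Longrightarrow> simple_function M Y \<Longrightarrow>
      card (range X) \<le> k \<Longrightarrow> prob {x. X x \<noteq> g (Y x)} \<le> \<eta> \<Longrightarrow>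
      entropy_of (\<lambda>x. (X x, Y x)) \<le> entropy_of Y + e"
    using entropy_of_approx[OF \<open>0 < e\<close>, of k] by blast
  \<comment> \<open>At most \<open>k\<close> cells err by \<open>\<epsilon>\<close> each, so the
    total stays within \<open>\<eta>\<close>. Since \<open>\<eta>\<close> came from \<open>e\<close>
    and \<open>k\<close> alone, \<open>\<epsilon>\<close>, \<open>\<delta>\<close> and
    \<open>Q\<close> are all chosen independently of \<open>n\<close>.\<close>
  define \<epsilon> where "\<epsilon> = \<eta> / (real k + 1)"
  have "0 < \<epsilon>" using \<eta> by (simp add: \<epsilon>_def)
  from P this obtain \<delta> K where "0 < \<delta>"
    and K: "\<And>n A. A \<in> P n \<Longrightarrow> compact (K n A)" "\<And>n A. A \<in> P n \<Longrightarrow> K n A \<subseteq> A"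
      "\<And>n A. A \<in> P n \<Longrightarrow> prob (A - K n A) \<le> \<epsilon>"
    and sep: "\<And>n A B x y. A \<in> P n \<Longrightarrow> B \<in> P n \<Longrightarrow> A \<noteq> B \<Longrightarrow> x \<in> K n A \<Longrightarrow> y \<in> K n B
      \<Longrightarrow> \<delta> \<le> dist x y"
    by (rule admissible_partitionsE) (rule that; assumption)
  obtain Q :: "'a set set" where Q: "finite_borel_partition Q" "\<And>A x y. A \<in> Q \<Longrightarrow> x \<in> A \<Longrightarrow> y \<in> A \<Longrightarrow> dist x y < \<delta>"
    using exists_fine_partition[OF compact_UNIV \<open>0 < \<delta>\<close>] by blast
  have Q': "partition_on UNIV Q" using Q(1) by (simp add: finite_borel_partition_def)
  have "entropy_of (\<lambda>x. (cell (P n) x, cell Q x)) \<le> entropy_of (cell Q) + e" for n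
  proof -
    \<comment> \<open>\<open>g B\<close> picks a cell whose compact core meets \<open>B\<close>. If
      there is none the value is arbitrary; the points of such a \<open>B\<close> lie outside all
      cores and are covered by the error set.\<close>
    define g where "g B = (SOME A. A \<in> P n \<and> B \<inter> K n A \<noteq> {})" for B
    have sf: "simple_function M (cell (P n))" "simple_function M (cell Q)"
      using simple_function_cell[OF sets_borel] fbp Q by auto
    have card: "card (range (cell (P n))) \<le> k"
      by (rule order_trans[OF card_mono[OF Pn(1) range_cell[OF Pn(2)]] k])
    \<comment> \<open>The point \<open>x\<close> and a witness \<open>y\<close> for \<open>g\<close>
      lie in one cell of \<open>Q\<close>, hence closer than \<open>\<delta>\<close>; cores of
      distinct cells are at least \<open>\<delta>\<close> apart.\<close>
    have "cell (P n) x = g (cell Q x)" if "x \<in> K n (cell (P n) x)" for x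
    proof -
      have ex: "cell (P n) x \<in> P n \<and> cell Q x \<inter> K n (cell (P n) x) \<noteq> {}"
        using that cell_mem[OF Q', of x] cell_mem[OF Pn(2)] by auto
      then have g: "g (cell Q x) \<in> P n" "cell Q x \<inter> K n (g (cell Q x)) \<noteq> {}"
        unfolding g_def using someI[of "\<lambda>A. A \<in> P n \<and> cell Q x \<inter> K n A \<noteq> {}"] by auto
      then obtain y where y: "y \<in> cell Q x" "y \<in> K n (g (cell Q x))" by auto
      have "dist x y < \<delta>" using Q(2) cell_mem[OF Q'] y(1) by blast
      then show ?thesis using sep[of "cell (P n) x" n "g (cell Q x)" x y] ex g that y by force
    qed
    then have sub: "{x. cell (P n) x \<noteq> g (cell Q x)} \<subseteq> (\<Union>A\<in>P n. A - K n A)"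
      using cell_mem[OF Pn(2)[of n]] by blast
    have mA: "A - K n A \<in> sets M" if "A \<in> P n" for A
      using Pn(3)[of n] that K(1)[OF that] sets_borel by (intro sets.Diff) (auto intro: borel_compact)
    have "prob {x. cell (P n) x \<noteq> g (cell Q x)} \<le> prob (\<Union>A\<in>P n. A - K n A)"
      using sub mA Pn(1) by (intro finite_measure_mono) auto
    also have "\<dots> \<le> (\<Sum>A\<in>P n. prob (A - K n A))"
      using mA Pn(1) by (intro finite_measure_subadditive_finite) auto
    also have "\<dots> \<le> real (card (P n)) * \<epsilon>" using K(3) by (intro sum_bounded_above) auto
    also have "\<dots> \<le> (real k + 1) * \<epsilon>" using k[of n] \<open>0 < \<epsilon>\<close> by (intro mult_right_mono) auto
    also have "\<dots> = \<eta>" by (simp add: \<epsilon>_def)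
    finally show ?thesis by (rule approx[OF sf card])
  qed
  then show ?thesis using Q(1) by blast
qed

context
  fixes f :: "'a \<Rightarrow> 'a"
  assumes f: "f \<in> measurable M M" "distr M M f = M"
begin

text \<open>By subadditivity, \<open>lim\<close> in the classical entropy is a genuine finite limit
  and not an unspecified value.\<close>

lemma entropy_rate_tendsto:
  assumes "finite_borel_partition P"
  shows "\<exists>L. (\<lambda>n. partition_entropy M (orbit_join (\<lambda>_. f) (\<lambda>_. P) n) / real n) \<longlonglongrightarrow> L
    \<and> ks_entropy_partition f M P = ereal L"
proof -
  have P: "partition_on UNIV P" using assms by (simp add: finite_borel_partition_def)
  obtain L where L: "(\<lambda>n. partition_entropy M (orbit_join (\<lambda>_. f) (\<lambda>_. P) n) / real n) \<longlonglongrightarrow> L"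
    using convergent_entropy_rate[OF simple_function_cell[OF sets_borel assms] f]
    by (auto simp: orbit_join_const_eq_level_sets[OF P] convergent_def)
  then have "lim (\<lambda>n. ereal (partition_entropy M (orbit_join (\<lambda>_. f) (\<lambda>_. P) n) / real n)) = ereal L"
    by (intro limI tendsto_intros)
  then show ?thesis
    using L by (auto simp: ks_entropy_partition_def orbit_join_def orbit_map_const)
qed

lemma entropy_wrt_const_partition:
  assumes "finite_borel_partition P"
  shows "entropy_wrt_partitions (\<lambda>_. f) (\<lambda>_. M) (\<lambda>_. P) = ks_entropy_partition f M P"
  using entropy_rate_tendsto[OF assms] unfolding entropy_wrt_partitions_def
  by (auto intro!: lim_imp_Limsup tendsto_intros)

text \<open>Passing to the joint itinerary and then removing \<open>P\<close> costs a conditional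
  entropy of at most \<open>e\<close> per time step, hence \<open>e\<close> after division by
  \<open>n\<close>.\<close>

lemma entropy_wrt_admissible_le:
  assumes P: "P \<in> admissible_partitions (\<lambda>_. M)" and e: "0 < e"
  shows "entropy_wrt_partitions (\<lambda>_. f) (\<lambda>_. M) P \<le> ks_entropy f M + ereal e"
proof -
  obtain Q where Q: "finite_borel_partition Q"
    and le: "\<And>n. entropy_of (\<lambda>x. (cell (P n) x, cell Q x)) \<le> entropy_of (cell Q) + e"
    using admissible_uniform_approx[OF P e] by blast
  have fbp: "finite_borel_partition (P n)" for n using P by (auto simp: admissible_partitions_def)
  then have Pn: "partition_on UNIV (P n)" for n by (simp add: finite_borel_partition_def)
  have Q': "partition_on UNIV Q" using Q by (simp add: finite_borel_partition_def)
  have ff: "f ^^ i \<in> measurable M M" "distr M M (f ^^ i) = M" for i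
    using funpow_preserving[OF f] by auto
  note sf = simple_function_cell[OF sets_borel fbp] simple_function_cell[OF sets_borel Q]
  let ?X = "\<lambda>i x. cell (P i) ((f ^^ i) x)" and ?Y = "\<lambda>i x. cell Q ((f ^^ i) x)"
  have sfX: "simple_function M (?X i)" and sfY: "simple_function M (?Y i)" for i
    by (rule simple_function_comp[OF ff(1)]; rule sf)+
  have "entropy_of (itinerary ?X n) \<le> entropy_of (itinerary ?Y n) + real n * e" for n
  proof -
    have "entropy_of (itinerary ?X n) \<le> entropy_of (\<lambda>x. (itinerary ?X n x, itinerary ?Y n x))"
      by (intro entropy_of_mono_pair simple_function_itinerary sfX sfY)
    also have "\<dots> \<le> entropy_of (itinerary ?Y n)
        + (\<Sum>i<n. entropy_of (\<lambda>x. (?X i x, ?Y i x)) - entropy_of (?Y i))"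
      by (intro entropy_of_itinerary_le sfX sfY)
    also have "(\<Sum>i<n. entropy_of (\<lambda>x. (?X i x, ?Y i x)) - entropy_of (?Y i)) \<le> (\<Sum>i<n. e)"
    proof (rule sum_mono)
      fix i
      \<comment> \<open>Invariance moves the pair at time \<open>i\<close> back to time 0, where the
        choice of \<open>Q\<close> bounds it.\<close>
      show "entropy_of (\<lambda>x. (?X i x, ?Y i x)) - entropy_of (?Y i) \<le> e"
        using le[of i] entropy_of_preserving[OF sf(2) ff, of i]
          entropy_of_preserving[OF simple_function_Pair[OF sf], of "f ^^ i" i, OF ff] by simp
    qed
    finally show ?thesis by simp
  qed
  then have *: "partition_entropy M (orbit_join (\<lambda>_. f) P n)
      \<le> partition_entropy M (orbit_join (\<lambda>_. f) (\<lambda>_. Q) n) + real n * e" for n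
    by (simp add: orbit_join_const_eq_level_sets Pn Q')
  obtain L where L: "(\<lambda>n. partition_entropy M (orbit_join (\<lambda>_. f) (\<lambda>_. Q) n) / real n) \<longlonglongrightarrow> L"
    "ks_entropy_partition f M Q = ereal L"
    using entropy_rate_tendsto[OF Q] by blast
  have "entropy_wrt_partitions (\<lambda>_. f) (\<lambda>_. M) P
      \<le> limsup (\<lambda>n. ereal (partition_entropy M (orbit_join (\<lambda>_. f) (\<lambda>_. Q) n) / real n + e))"
    unfolding entropy_wrt_partitions_def
  proof (rule Limsup_mono, rule eventually_sequentiallyI[of 1])
    fix n :: nat assume "1 \<le> n"
    then show "ereal (partition_entropy M (orbit_join (\<lambda>_. f) P n) / real n)
        \<le> ereal (partition_entropy M (orbit_join (\<lambda>_. f) (\<lambda>_. Q) n) / real n + e)"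
      using *[of n] by (simp add: field_simps)
  qed
  also have "\<dots> = ereal (L + e)"
    by (intro lim_imp_Limsup tendsto_intros L(1)) simp
  also have "\<dots> = ks_entropy_partition f M Q + ereal e" by (simp add: L)
  also have "\<dots> \<le> ks_entropy f M + ereal e"
    unfolding ks_entropy_def using Q by (intro add_right_mono SUP_upper) auto
  finally show ?thesis .
qed

lemma nonautonomous_entropy_const: "nonautonomous_entropy (\<lambda>_. f) (\<lambda>_. M) = ks_entropy f M"
proof (rule antisym)
  \<comment> \<open>The bound holds with every positive error \<open>e\<close>, which now tends to
    0; in \<open>ereal\<close> this covers an infinite right-hand side too.\<close>
  show "nonautonomous_entropy (\<lambda>_. f) (\<lambda>_. M) \<le> ks_entropy f M"
    unfolding nonautonomous_entropy_def
    by (rule SUP_least, rule ereal_le_epsilon2, rule entropy_wrt_admissible_le)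
  show "ks_entropy f M \<le> nonautonomous_entropy (\<lambda>_. f) (\<lambda>_. M)"
    unfolding ks_entropy_def
  proof (rule SUP_least, clarify)
    fix P :: "'a set set" assume P: "finite_borel_partition P"
    then have "(\<lambda>_. P) \<in> admissible_partitions (\<lambda>_. M)"
      by (intro const_admissible compact_UNIV finite_measure_axioms sets_borel)
    then show "ks_entropy_partition f M P \<le> nonautonomous_entropy (\<lambda>_. f) (\<lambda>_. M)"
      unfolding nonautonomous_entropy_def
      by (subst entropy_wrt_const_partition[OF P, symmetric]) (rule SUP_upper)
  qed
qed

end

end

theorem corollary3p10:
  fixes f :: "'a::metric_space \<Rightarrow> 'a" and M :: "'a measure"
  assumes "compact (UNIV :: 'a set)"
    and "continuous_on UNIV f"
    and "prob_space M" and "sets M = sets borel"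
    and "distr M M f = M"
  shows "nonautonomous_entropy (\<lambda>_. f) (\<lambda>_. M) = ks_entropy f M"
proof -
  interpret prob_space M by fact
  interpret compact_full_prob_space M
    using assms sets_eq_imp_space_eq[of M borel] by unfold_locales auto
  have "f \<in> measurable M M"
    using borel_measurable_continuous_onI[OF assms(2)]
    by (simp add: measurable_cong_sets[OF assms(4) assms(4)])
  then show ?thesis using assms(5) by (rule nonautonomous_entropy_const)
qed

end
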